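(* Let $G=(V,E)$ be a connected, undirected, unweighted graph, $R\subseteq V$ a set of landmarks and $H=(R,\delta_H)$ the highway. Let $L$ be the labelling constructed by Algorithm 1 (described in the context). Then $L$ is minimal: for every highway cover distance labelling $L'$ over $(G,H)$, $size(L')\geq size(L)$.
   Context: $d_G(u,v)$ denotes the shortest-path distance in $G$. A vertex $x$ lies on a shortest path between $u$ and $w$ if $d_G(u,x)+d_G(x,w)=d_G(u,w)$. A highway is a pair $H=(R,\delta_H)$ with $\delta_H(r_1,r_2)=d_G(r_1,r_2)$ for all $r_1,r_2\in R$. A distance labelling assigns to each $v\in V\setminus R$ a label $L(v)$, a set of entries $(r,\delta_L(r,v))$ with $r\in R$ (at most one entry per landmark) and $\delta_L(r,v)=d_G(r,v)$; its size is $size(L)=\sum_{v}|L(v)|$. A highway cover distance labelling over $(G,H)$ is a distance labelling such that for all $s,t\in V\setminus R$ (not necessarily distinct) and every $r\in R$ there exist $(r_i,\delta_L(r_i,s))\in L(s)$ and $(r_j,\delta_L(r_j,t))\in L(t)$ such that $r_i$ lies on a shortest path between $r$ and $s$ and $r_j$ lies on a shortest path between $r$ and $t$ (possibly $r_i=r$ or $r_j=r$). Algorithm 1: initialise $L(v)=\emptyset$ for all $v\in V\setminus R$. For each $r_i\in R$ (in any order) run the following pruned BFS, in which each vertex is visited at most once and the root $r_i$ is visited at depth $0$. Keep two queues $\mathcal{Q}_{label}=\{r_i\}$ and $\mathcal{Q}_{prune}=\emptyset$ and set $n=0$. While $\mathcal{Q}_{label}$ contains vertices of depth $n$: (i) for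 each $u\in\mathcal{Q}_{label}$ at depth $n$ and each unvisited neighbour $v$ of $u$ (which becomes visited at depth $n+1$): if $v\in R$, enqueue $v$ to $\mathcal{Q}_{prune}$; otherwise enqueue $v$ to $\mathcal{Q}_{label}$ and add $(r_i,n+1)$ to $L(v)$; (ii) set $n\gets n+1$; (iii) for each $v\in\mathcal{Q}_{prune}$ at depth $n$, mark every unvisited neighbour of $v$ as visited at depth $n+1$ and enqueue it to $\mathcal{Q}_{prune}$ (no label is added). The output is $L$. *)

theory Defs
  imports "Graph_Theory.Graph_Theory" "HOL-Library.While_Combinator"
begin

text \<open>
  An undirected graph \<open>(V, E)\<close> is a finite symmetric relation \<open>E\<close> on a finite set \<open>V\<close>, i.e. a
  \<open>pair_pseudo_graph\<close>; loops are permitted, and simple graphs (\<open>pair_graph\<close>) are a special case.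
\<close>

definition graph_dist :: "'v pair_pre_digraph \<Rightarrow> 'v \<Rightarrow> 'v \<Rightarrow> nat" where
  "graph_dist G u v = (LEAST n. \<exists>p. pre_digraph.awalk (with_proj G) u p v \<and> length p = n)"

text \<open>
  The weighted shortest-path distance of the library, for unit weights, is \<open>graph_dist\<close>.
  It is not used directly because its values are extended reals.
\<close>

lemma (in pair_wf_digraph) mu_unit_weight_eq_graph_dist:
  assumes "u \<rightarrow>\<^sup>*\<^bsub>with_proj G\<^esub> v"
  shows "\<mu> (\<lambda>_. 1) u v = ereal (real (graph_dist G u v))"
proof -
  have cost: "awalk_cost (\<lambda>_. 1) p = real (length p)" for p :: "('a \<times> 'a) list"
    by (induction p) auto
  have "\<exists>n p. awalk u p v \<and> length p = n"
    using assms by (auto simp: reachable_awalk)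
  then obtain p where p: "awalk u p v" "length p = graph_dist G u v"
    unfolding graph_dist_def by (rule LeastI_ex[THEN exE]) auto
  have least: "graph_dist G u v \<le> length q" if "awalk u q v" for q
    unfolding graph_dist_def using that by (intro Least_le) auto
  show ?thesis
  proof (rule antisym)
    show "\<mu> (\<lambda>_. 1) u v \<le> ereal (real (graph_dist G u v))"
      using min_cost_le_walk_cost[OF p(1), of "\<lambda>_. 1"] p(2) by (simp add: cost)
    show "ereal (real (graph_dist G u v)) \<le> \<mu> (\<lambda>_. 1) u v"
      unfolding \<mu>_def by (rule INF_greatest) (auto simp: cost least)
  qed
qed

definition on_shortest_path :: "'v pair_pre_digraph \<Rightarrow> 'v \<Rightarrow> 'v \<Rightarrow> 'v \<Rightarrow> bool" where
  "on_shortest_path G u x w \<longleftrightarrow> graph_dist G u x + graph_dist G x w = graph_dist G u w"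

type_synonym 'v highway = "'v set \<times> ('v \<Rightarrow> 'v \<Rightarrow> nat)"

definition is_highway :: "'v pair_pre_digraph \<Rightarrow> 'v highway \<Rightarrow> bool" where
  "is_highway G H \<longleftrightarrow> fst H \<subseteq> pverts G \<and>
     (\<forall>r1\<in>fst H. \<forall>r2\<in>fst H. snd H r1 r2 = graph_dist G r1 r2)"

text \<open>Only the values of a labelling on \<open>V - R\<close> are meaningful.\<close>

type_synonym 'v labelling = "'v \<Rightarrow> ('v \<times> nat) set"

definition distance_labelling :: "'v pair_pre_digraph \<Rightarrow> 'v set \<Rightarrow> 'v labelling \<Rightarrow> bool" where
  "distance_labelling G R L \<longleftrightarrow>
     (\<forall>v\<in>pverts G - R.
        (\<forall>(r, d)\<in>L v. r \<in> R \<and> d = graph_dist G r v) \<and>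
        (\<forall>(r, d)\<in>L v. \<forall>(r', d')\<in>L v. r = r' \<longrightarrow> d = d'))"

definition labelling_size :: "'v pair_pre_digraph \<Rightarrow> 'v set \<Rightarrow> 'v labelling \<Rightarrow> nat" where
  "labelling_size G R L = (\<Sum>v\<in>pverts G - R. card (L v))"

definition highway_cover_labelling ::
  "'v pair_pre_digraph \<Rightarrow> 'v highway \<Rightarrow> 'v labelling \<Rightarrow> bool" where
  "highway_cover_labelling G H L \<longleftrightarrow>
     distance_labelling G (fst H) L \<and>
     (\<forall>s\<in>pverts G - fst H. \<forall>t\<in>pverts G - fst H. \<forall>r\<in>fst H.
        \<exists>(ri, di)\<in>L s. \<exists>(rj, dj)\<in>L t.
          on_shortest_path G r ri s \<and> on_shortest_path G r rj t)"

text \<open>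
  State of the pruned breadth-first search from one landmark. \<open>vdepth s v\<close> is \<open>None\<close> while \<open>v\<close> is
  unvisited and \<open>Some d\<close> once \<open>v\<close> has been visited at depth \<open>d\<close>. Nothing is removed from the
  queues: the algorithm selects vertices from them by depth. The labelling \<open>labels\<close> is shared by
  the searches from all landmarks.
\<close>

record 'v bfs_state =
  vdepth :: "'v \<Rightarrow> nat option"
  q_label :: "'v list"
  q_prune :: "'v list"
  level :: nat
  labels :: "'v labelling"

definition at_depth :: "'v bfs_state \<Rightarrow> nat \<Rightarrow> 'v list \<Rightarrow> 'v list" where
  "at_depth s n q = filter (\<lambda>u. vdepth s u = Some n) q"

definition label_visit :: "'v set \<Rightarrow> 'v \<Rightarrow> 'v \<Rightarrow> 'v bfs_state \<Rightarrow> 'v bfs_state" where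
  "label_visit R r v s =
     (if vdepth s v \<noteq> None then s
      else let s' = s\<lparr>vdepth := (vdepth s)(v \<mapsto> level s + 1)\<rparr> in
        if v \<in> R then s'\<lparr>q_prune := q_prune s @ [v]\<rparr>
        else s'\<lparr>q_label := q_label s @ [v],
                labels := (labels s)(v := insert (r, level s + 1) (labels s v))\<rparr>)"

definition prune_visit :: "'v \<Rightarrow> 'v bfs_state \<Rightarrow> 'v bfs_state" where
  "prune_visit v s =
     (if vdepth s v \<noteq> None then s
      else s\<lparr>vdepth := (vdepth s)(v \<mapsto> level s + 1), q_prune := q_prune s @ [v]\<rparr>)"

text \<open>
  \<open>nbs u\<close> lists the neighbours of \<open>u\<close> in the order in which they are examined, and \<open>rs\<close> below
  lists the landmarks in the order in which they are processed; both orders are arbitrary.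
\<close>

definition adjacency_lists :: "'v pair_pre_digraph \<Rightarrow> ('v \<Rightarrow> 'v list) \<Rightarrow> bool" where
  "adjacency_lists G nbs \<longleftrightarrow>
     (\<forall>u\<in>pverts G. distinct (nbs u) \<and> set (nbs u) = {v. (u, v) \<in> parcs G})"

definition label_phase ::
  "('v \<Rightarrow> 'v list) \<Rightarrow> 'v set \<Rightarrow> 'v \<Rightarrow> 'v bfs_state \<Rightarrow> 'v bfs_state" where
  "label_phase nbs R r s =
     fold (\<lambda>u. fold (label_visit R r) (nbs u)) (at_depth s (level s) (q_label s)) s"

definition prune_phase :: "('v \<Rightarrow> 'v list) \<Rightarrow> 'v bfs_state \<Rightarrow> 'v bfs_state" where
  "prune_phase nbs s =
     fold (\<lambda>v. fold prune_visit (nbs v)) (at_depth s (level s) (q_prune s)) s"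

definition bfs_round ::
  "('v \<Rightarrow> 'v list) \<Rightarrow> 'v set \<Rightarrow> 'v \<Rightarrow> 'v bfs_state \<Rightarrow> 'v bfs_state" where
  "bfs_round nbs R r s =
     (let s1 = label_phase nbs R r s;
          s2 = s1\<lparr>level := level s1 + 1\<rparr>
      in prune_phase nbs s2)"

definition bfs_init :: "'v \<Rightarrow> 'v labelling \<Rightarrow> 'v bfs_state" where
  "bfs_init r L = \<lparr>vdepth = [r \<mapsto> 0], q_label = [r], q_prune = [], level = 0, labels = L\<rparr>"

definition pruned_bfs ::
  "('v \<Rightarrow> 'v list) \<Rightarrow> 'v set \<Rightarrow> 'v \<Rightarrow> 'v labelling \<Rightarrow> 'v labelling" where
  "pruned_bfs nbs R r L =
     labels (while (\<lambda>s. at_depth s (level s) (q_label s) \<noteq> []) (bfs_round nbs R r) (bfs_init r L))"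

definition highway_labelling :: "('v \<Rightarrow> 'v list) \<Rightarrow> 'v list \<Rightarrow> 'v labelling" where
  "highway_labelling nbs rs = fold (pruned_bfs nbs (set rs)) rs (\<lambda>_. {})"

end

theory Submission
  imports Defs
begin

text \<open>
  Call \<open>v\<close> shadowed from \<open>r\<close> if some other landmark lies on a shortest path from \<open>r\<close> to \<open>v\<close>.
  If \<open>v \<notin> R\<close> is not shadowed from \<open>r\<close>, then the cover condition for \<open>s = t = v\<close> and the landmark
  \<open>r\<close> can only be met by the entry for \<open>r\<close> itself, so every highway cover labelling contains
  \<open>(r, d(r, v))\<close> in the label of \<open>v\<close>. Conversely, the pruned search from \<open>r\<close> adds only such entries:
  a vertex at distance \<open>n + 1\<close> is shadowed iff it is a landmark or has a shadowed neighbour at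
  distance \<open>n\<close>, and since the pruned vertices of depth \<open>n\<close> are expanded before the labelled ones of
  depth \<open>n\<close>, the two queues hold exactly the shadowed and the unshadowed visited vertices.
\<close>

definition shadowed :: "'v pair_pre_digraph \<Rightarrow> 'v set \<Rightarrow> 'v \<Rightarrow> 'v \<Rightarrow> bool" where
  "shadowed G R r v \<longleftrightarrow> (\<exists>r'\<in>R. r' \<noteq> r \<and> on_shortest_path G r r' v)"

lemma highway_cover_contains_unshadowed:
  assumes "highway_cover_labelling G (R, \<delta>) L'" "v \<in> pverts G - R" "r \<in> R" "\<not> shadowed G R r v"
  shows "(r, graph_dist G r v) \<in> L' v"
proof -
  obtain r' k where r': "(r', k) \<in> L' v" "on_shortest_path G r r' v"
    using assms(1-3) unfolding highway_cover_labelling_def by fastforce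
  then have "r' \<in> R" "k = graph_dist G r' v"
    using assms(1,2) unfolding highway_cover_labelling_def distance_labelling_def by auto
  with r' assms(4) show ?thesis unfolding shadowed_def by auto
qed

section \<open>Effect of the visiting loops on the search state\<close>

text \<open>The level is constant during a loop, so every newly visited vertex gets the same depth.
  Hence the outcome depends only on the set of listed vertices and the state before the loop. Queues
  are described as sets, which removes the order of examination.\<close>

lemma fold_label_visit:
  "level (fold (label_visit R r) xs s) = level s"
  "vdepth (fold (label_visit R r) xs s) v =
     (if vdepth s v = None \<and> v \<in> set xs then Some (Suc (level s)) else vdepth s v)"
  "set (q_label (fold (label_visit R r) xs s)) =
     set (q_label s) \<union> {v \<in> set xs - R. vdepth s v = None}"
  "set (q_prune (fold (label_visit R r) xs s)) =
     set (q_prune s) \<union> {v \<in> set xs \<inter> R. vdepth s v = None}"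
  "labels (fold (label_visit R r) xs s) v =
     labels s v \<union> (if v \<in> set xs - R \<and> vdepth s v = None then {(r, Suc (level s))} else {})"
proof (induction xs arbitrary: s)
  case (Cons x xs)
  { case 1 show ?case by (simp add: Cons.IH) (simp add: label_visit_def Let_def) }
  { case 2 show ?case by (simp add: Cons.IH) (auto simp: label_visit_def Let_def) }
  { case 3 show ?case by (simp add: Cons.IH) (auto simp: label_visit_def Let_def) }
  { case 4 show ?case by (simp add: Cons.IH) (auto simp: label_visit_def Let_def) }
  { case 5 show ?case by (simp add: Cons.IH) (auto simp: label_visit_def Let_def) }
qed auto

lemma fold_prune_visit:
  "level (fold prune_visit xs s) = level s"
  "vdepth (fold prune_visit xs s) v =
     (if vdepth s v = None \<and> v \<in> set xs then Some (Suc (level s)) else vdepth s v)"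
  "q_label (fold prune_visit xs s) = q_label s"
  "set (q_prune (fold prune_visit xs s)) = set (q_prune s) \<union> {v \<in> set xs. vdepth s v = None}"
  "labels (fold prune_visit xs s) = labels s"
proof (induction xs arbitrary: s)
  case (Cons x xs)
  { case 1 show ?case by (simp add: Cons.IH) (simp add: prune_visit_def) }
  { case 2 show ?case by (simp add: Cons.IH) (auto simp: prune_visit_def) }
  { case 3 show ?case by (simp add: Cons.IH) (auto simp: prune_visit_def) }
  { case 4 show ?case by (simp add: Cons.IH) (auto simp: prune_visit_def) }
  { case 5 show ?case by (simp add: Cons.IH) (auto simp: prune_visit_def) }
qed auto

text \<open>Flattens the nested loops of a phase, so that the descriptions of a single loop apply to
  the whole phase.\<close>

lemma fold_fold_concat_map: "fold (\<lambda>u. fold f (g u)) xs s = fold f (concat (map g xs)) s"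
  by (induction xs arbitrary: s) auto

section \<open>Distances in a connected graph\<close>

locale connected_pair_pseudo_graph = pair_pseudo_graph G for G :: "'v pair_pre_digraph" +
  assumes conn: "Digraph_Component.connected (with_proj G)"
begin

lemma graph_dist_le_length: "awalk u p v \<Longrightarrow> graph_dist G u v \<le> length p"
  unfolding graph_dist_def by (rule Least_le) auto

lemma shortest_awalk:
  assumes "u \<in> pverts G" "v \<in> pverts G"
  obtains p where "awalk u p v" "length p = graph_dist G u v"
proof -
  \<comment> \<open>Connectedness refers to the symmetric closure; as the arcs are already
    symmetric, it yields directed reachability, so the \<open>LEAST\<close> in
    \<open>graph_dist\<close> is attained.\<close>
  have "u \<rightarrow>\<^sup>*\<^bsub>with_proj G\<^esub> v"
    using symmetric_connected_imp_strongly_connected[OF _ conn] sym_arcs assms by auto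
  then have "\<exists>n p. awalk u p v \<and> length p = n" by (auto simp: reachable_awalk)
  then have "\<exists>p. awalk u p v \<and> length p = graph_dist G u v"
    unfolding graph_dist_def by (rule LeastI_ex)
  with that show thesis by blast
qed

lemma graph_dist_self: "v \<in> pverts G \<Longrightarrow> graph_dist G v v = 0"
  using graph_dist_le_length[of v "[]" v] by (simp add: awalk_Nil_iff)

lemma graph_dist_eq_0_iff:
  assumes "u \<in> pverts G" "v \<in> pverts G"
  shows "graph_dist G u v = 0 \<longleftrightarrow> u = v"
proof
  assume "graph_dist G u v = 0"
  moreover obtain p where "awalk u p v" "length p = graph_dist G u v"
    using shortest_awalk assms .
  ultimately show "u = v" by (simp add: awalk_Nil_iff)
qed (use graph_dist_self assms in auto)

lemma graph_dist_triangle: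
  assumes "u \<in> pverts G" "v \<in> pverts G" "w \<in> pverts G"
  shows "graph_dist G u w \<le> graph_dist G u v + graph_dist G v w"
proof -
  obtain p q where "awalk u p v" "length p = graph_dist G u v"
    "awalk v q w" "length q = graph_dist G v w"
    using shortest_awalk assms by metis
  then show ?thesis using graph_dist_le_length[of u "p @ q" w] awalk_appendI by fastforce
qed

lemma arc_in_verts: "(u, v) \<in> parcs G \<Longrightarrow> u \<in> pverts G \<and> v \<in> pverts G"
  using in_arcsD1 in_arcsD2 by auto

lemma graph_dist_arc_le:
  assumes "r \<in> pverts G" "(u, v) \<in> parcs G"
  shows "graph_dist G r v \<le> Suc (graph_dist G r u)"
proof -
  have "awalk u [(u, v)] v" using assms arc_in_verts by (simp add: awalk_simps)
  then have "graph_dist G u v \<le> 1" using graph_dist_le_length[of u "[(u, v)]" v] by simp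
  moreover have "graph_dist G r v \<le> graph_dist G r u + graph_dist G u v"
    using graph_dist_triangle assms arc_in_verts by blast
  ultimately show ?thesis by linarith
qed

text \<open>Drop the last arc of a shortest walk; if the rest were not shortest,
  \<open>graph_dist_arc_le\<close> would make \<open>v\<close> closer than assumed.\<close>

lemma graph_dist_predecessor:
  assumes "r \<in> pverts G" "v \<in> pverts G" "graph_dist G r v = Suc n"
  obtains u where "(u, v) \<in> parcs G" "graph_dist G r u = n"
proof -
  obtain p where p: "awalk r p v" "length p = Suc n" using shortest_awalk assms by metis
  then obtain q e where q: "p = q @ [e]" by (cases p rule: rev_cases) auto
  obtain u w where e: "e = (u, w)" by (cases e)
  have *: "awalk r q u" "(u, v) \<in> parcs G" using p(1) unfolding q e by (auto simp: awalk_simps)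
  have "graph_dist G r u \<le> n" using graph_dist_le_length[OF *(1)] p(2) q by simp
  moreover have "Suc n \<le> Suc (graph_dist G r u)"
    using graph_dist_arc_le[OF assms(1) *(2)] assms(3) by simp
  ultimately show thesis using that * by auto
qed

section \<open>Propagation of shadowing along shortest paths\<close>

context
  fixes R :: "'v set" and r :: 'v
  assumes R_subset: "R \<subseteq> pverts G" and r_in_R: "r \<in> R"
begin

abbreviation (input) d :: "'v \<Rightarrow> nat" where "d \<equiv> graph_dist G r"

lemma r_in_verts: "r \<in> pverts G"
  using R_subset r_in_R by auto

lemma not_shadowed_root: "\<not> shadowed G R r r"
  unfolding shadowed_def on_shortest_path_def
  using graph_dist_eq_0_iff r_in_verts R_subset by (metis add_is_0 subsetD)

text \<open>The witness is \<open>v\<close> itself.\<close>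

lemma shadowed_landmark: "v \<in> R \<Longrightarrow> v \<noteq> r \<Longrightarrow> shadowed G R r v"
  unfolding shadowed_def on_shortest_path_def using graph_dist_self R_subset
  by (metis add.right_neutral subsetD)

text \<open>The landmark that shadows \<open>u\<close> also shadows \<open>v\<close>: the arc adds
  at most one to its distance, and the triangle inequality excludes less.\<close>

lemma shadowed_successor:
  assumes "(u, v) \<in> parcs G" "d v = Suc (d u)" "shadowed G R r u"
  shows "shadowed G R r v"
proof -
  obtain x where x: "x \<in> R" "x \<noteq> r" "d x + graph_dist G x u = d u"
    using assms(3) unfolding shadowed_def on_shortest_path_def by auto
  have xV: "x \<in> pverts G" using x R_subset by auto
  have "graph_dist G x v \<le> Suc (graph_dist G x u)" using graph_dist_arc_le[OF xV assms(1)] .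
  moreover have "d v \<le> d x + graph_dist G x v"
    using graph_dist_triangle r_in_verts xV arc_in_verts assms(1) by blast
  ultimately have "d x + graph_dist G x v = d v" using x assms by linarith
  with x show ?thesis unfolding shadowed_def on_shortest_path_def by auto
qed

text \<open>Take the predecessor of \<open>v\<close> on a shortest path from the shadowing landmark
  \<open>x\<close>, not on an arbitrary one from \<open>r\<close>. Since \<open>v\<close> is no
  landmark, \<open>x\<close> differs from \<open>v\<close> and this predecessor exists.\<close>

lemma shadowed_predecessor:
  assumes "v \<in> pverts G" "shadowed G R r v" "v \<notin> R"
  obtains u where "(u, v) \<in> parcs G" "d v = Suc (d u)" "shadowed G R r u"
proof -
  obtain x where x: "x \<in> R" "x \<noteq> r" "d x + graph_dist G x v = d v"
    using assms(2) unfolding shadowed_def on_shortest_path_def by auto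
  have xV: "x \<in> pverts G" using x R_subset by auto
  have "graph_dist G x v \<noteq> 0" using graph_dist_eq_0_iff xV assms x by metis
  then obtain k where k: "graph_dist G x v = Suc k" by (cases "graph_dist G x v") auto
  obtain u where u: "(u, v) \<in> parcs G" "graph_dist G x u = k"
    using graph_dist_predecessor[OF xV assms(1) k] .
  have "d u \<le> d x + graph_dist G x u"
    using graph_dist_triangle r_in_verts xV arc_in_verts u by blast
  moreover have "d v \<le> Suc (d u)" using graph_dist_arc_le[OF r_in_verts u(1)] .
  ultimately have "d v = Suc (d u)" "d x + graph_dist G x u = d u" using u x k by linarith+
  with u x that show thesis unfolding shadowed_def on_shortest_path_def by auto
qed

section \<open>Invariant of the pruned search\<close>

text \<open>
  When a round at level \<open>n\<close> starts, the visited vertices of depth \<open>n + 1\<close> are exactly those that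
  the preceding prune phase has reached.
\<close>

definition early_shadowed :: "nat \<Rightarrow> 'v \<Rightarrow> bool" where
  "early_shadowed n v \<longleftrightarrow> d v = Suc n \<and> (\<exists>u. (u, v) \<in> parcs G \<and> d u = n \<and> shadowed G R r u)"

text \<open>The prune queue may be one depth ahead of the label queue, because a prune phase runs
  after the level has been raised. The last clause bounds the labels from above, relative to the
  labelling \<open>L\<close> inherited from earlier searches; this is the direction that the size
  comparison uses.\<close>

definition bfs_invariant :: "'v labelling \<Rightarrow> 'v bfs_state \<Rightarrow> bool" where
  "bfs_invariant L s \<longleftrightarrow>
     (\<forall>v. vdepth s v =
        (if v \<in> pverts G \<and> (d v \<le> level s \<or> early_shadowed (level s) v) then Some (d v) else None)) \<and>
     set (q_label s) = {v \<in> pverts G. d v \<le> level s \<and> \<not> shadowed G R r v} \<and>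
     set (q_prune s) =
       {v \<in> pverts G. (d v \<le> level s \<or> early_shadowed (level s) v) \<and> shadowed G R r v} \<and>
     (\<forall>v. \<forall>e\<in>labels s v. e \<in> L v \<or> e = (r, d v) \<and> \<not> shadowed G R r v)"

lemma bfs_invariant_init: "bfs_invariant L (bfs_init r L)"
proof -
  have root: "d v = 0 \<longleftrightarrow> v = r" if "v \<in> pverts G" for v
    using graph_dist_eq_0_iff[OF r_in_verts that] by auto
  \<comment> \<open>Only \<open>r\<close> has distance 0, and it is not shadowed.\<close>
  then have "\<not> early_shadowed 0 v" for v
    using not_shadowed_root arc_in_verts unfolding early_shadowed_def by metis
  with root not_shadowed_root r_in_verts graph_dist_self show ?thesis
    by (auto simp: bfs_invariant_def bfs_init_def)
qed

lemma bfs_round_invariant: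
  assumes nbs: "adjacency_lists G nbs" and inv: "bfs_invariant L s"
  shows "bfs_invariant L (bfs_round nbs R r s) \<and> level (bfs_round nbs R r s) = Suc (level s)"
proof -
  define n where "n = level s"
  define xs where "xs = concat (map nbs (at_depth s n (q_label s)))"
  define t where "t = fold (label_visit R r) xs s"
  define t' where "t' = t\<lparr>level := Suc n\<rparr>"
  define ys where "ys = concat (map nbs (at_depth t' (Suc n) (q_prune t')))"
  have t_level: "level t = n" by (simp add: t_def fold_label_visit n_def)
  have round: "bfs_round nbs R r s = fold prune_visit ys t'"
    using t_level
    by (simp add: bfs_round_def Let_def label_phase_def prune_phase_def fold_fold_concat_map
        ys_def t'_def t_def xs_def n_def)

  have dep: "vdepth s v = (if v \<in> pverts G \<and> (d v \<le> n \<or> early_shadowed n v) then Some (d v) else None)"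
    and ql: "set (q_label s) = {v \<in> pverts G. d v \<le> n \<and> \<not> shadowed G R r v}"
    and qp: "set (q_prune s) =
      {v \<in> pverts G. (d v \<le> n \<or> early_shadowed n v) \<and> shadowed G R r v}"
    and lab: "e \<in> labels s v \<Longrightarrow> e \<in> L v \<or> e = (r, d v) \<and> \<not> shadowed G R r v" for v e
    using inv unfolding bfs_invariant_def n_def by blast+
  have set_nbs: "set (nbs u) = {v. (u, v) \<in> parcs G}" if "u \<in> pverts G" for u
    using nbs that by (auto simp: adjacency_lists_def)
  have xs: "set xs = {v. \<exists>u. (u, v) \<in> parcs G \<and> d u = n \<and> \<not> shadowed G R r u}"
    using arc_in_verts by (fastforce simp: xs_def at_depth_def ql dep set_nbs early_shadowed_def)
  \<comment> \<open>The label phase visits all of distance \<open>n + 1\<close> that is still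
    unvisited: a vertex that is not early shadowed has only unshadowed predecessors at distance
    \<open>n\<close>, and these are in the label queue.\<close>
  have new: "v \<in> set xs \<and> vdepth s v = None \<longleftrightarrow> v \<in> pverts G \<and> d v = Suc n \<and> \<not> early_shadowed n v" for v
  proof
    assume "v \<in> set xs \<and> vdepth s v = None"
    moreover from this obtain u where "(u, v) \<in> parcs G" "d u = n" using xs by auto
    ultimately show "v \<in> pverts G \<and> d v = Suc n \<and> \<not> early_shadowed n v"
      using arc_in_verts graph_dist_arc_le[OF r_in_verts, of u v]
      by (auto simp: dep split: if_splits)
  next
    assume v: "v \<in> pverts G \<and> d v = Suc n \<and> \<not> early_shadowed n v"
    then obtain u where "(u, v) \<in> parcs G" "d u = n"
      using graph_dist_predecessor[OF r_in_verts] by blast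
    with v show "v \<in> set xs \<and> vdepth s v = None" by (auto simp: xs dep early_shadowed_def)
  qed
  have early: "shadowed G R r v" if "early_shadowed n v" for v n
    using that shadowed_successor unfolding early_shadowed_def by auto
  \<comment> \<open>Without a shadowed predecessor, a vertex is shadowed only by being a landmark,
    so the test \<open>v \<in> R\<close> in \<open>label_visit\<close> sorts the new vertices
    correctly.\<close>
  have new_shadowed: "shadowed G R r v \<longleftrightarrow> v \<in> R"
    if "v \<in> pverts G" "d v = Suc n" "\<not> early_shadowed n v" for v
  proof
    assume "shadowed G R r v"
    then show "v \<in> R"
      using shadowed_predecessor[OF that(1)] that(2,3) unfolding early_shadowed_def
      by (metis nat.inject)
  next
    assume "v \<in> R"
    moreover have "v \<noteq> r" using that graph_dist_self[OF r_in_verts] by auto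
    ultimately show "shadowed G R r v" by (rule shadowed_landmark)
  qed
  have early_d: "early_shadowed m v \<Longrightarrow> d v = Suc m" for m v by (simp add: early_shadowed_def)

  have t_dep: "vdepth t v = (if v \<in> pverts G \<and> d v \<le> Suc n then Some (d v) else None)" for v
  proof -
    have "vdepth t v = (if v \<in> set xs \<and> vdepth s v = None then Some (Suc n) else vdepth s v)"
      unfolding t_def fold_label_visit n_def by simp
    then show ?thesis unfolding new unfolding dep using early_d[of n v] by auto
  qed
  have t_ql: "set (q_label t) = {v \<in> pverts G. d v \<le> Suc n \<and> \<not> shadowed G R r v}"
  proof -
    have "set (q_label t) = set (q_label s) \<union> {v. (v \<in> set xs \<and> vdepth s v = None) \<and> v \<notin> R}"
      unfolding t_def fold_label_visit by auto
    then show ?thesis unfolding new ql using new_shadowed early by (auto simp: le_Suc_eq)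
  qed
  have t_qp: "set (q_prune t) = {v \<in> pverts G. d v \<le> Suc n \<and> shadowed G R r v}"
  proof -
    have "set (q_prune t) = set (q_prune s) \<union> {v. (v \<in> set xs \<and> vdepth s v = None) \<and> v \<in> R}"
      unfolding t_def fold_label_visit by auto
    then show ?thesis unfolding new qp using new_shadowed early_d by (auto simp: le_Suc_eq)
  qed
  have t_lab: "e \<in> L v \<or> e = (r, d v) \<and> \<not> shadowed G R r v" if "e \<in> labels t v" for v e
  proof (cases "e \<in> labels s v")
    case False
    with that have "v \<notin> R" "v \<in> set xs \<and> vdepth s v = None" "e = (r, Suc n)"
      unfolding t_def fold_label_visit by (auto simp: n_def split: if_splits)
    then show ?thesis unfolding new using new_shadowed by auto
  qed (rule lab)

  \<comment> \<open>At depth \<open>n + 1\<close> the prune queue now holds both the early shadowed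
    vertices and the landmarks just found.\<close>
  have ys: "set ys = {v. \<exists>u. (u, v) \<in> parcs G \<and> d u = Suc n \<and> shadowed G R r u}"
    using arc_in_verts by (fastforce simp: ys_def at_depth_def t'_def t_qp t_dep set_nbs)
  have new': "v \<in> set ys \<and> vdepth t v = None \<longleftrightarrow> v \<in> pverts G \<and> early_shadowed (Suc n) v" for v
  proof
    assume "v \<in> set ys \<and> vdepth t v = None"
    moreover from this obtain u where "(u, v) \<in> parcs G" "d u = Suc n" "shadowed G R r u"
      using ys by auto
    ultimately show "v \<in> pverts G \<and> early_shadowed (Suc n) v"
      using arc_in_verts graph_dist_arc_le[OF r_in_verts, of u v]
      by (fastforce simp: t_dep early_shadowed_def split: if_splits)
  qed (auto simp: ys t_dep early_shadowed_def)

  let ?s = "fold prune_visit ys t'"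
  have lev: "level ?s = Suc n" by (simp add: fold_prune_visit t'_def)
  moreover have "vdepth ?s v = (if v \<in> pverts G \<and> (d v \<le> Suc n \<or> early_shadowed (Suc n) v)
      then Some (d v) else None)" for v
  proof -
    have "vdepth ?s v = (if v \<in> set ys \<and> vdepth t v = None then Some (Suc (Suc n)) else vdepth t v)"
      by (simp add: fold_prune_visit t'_def)
    then show ?thesis unfolding new' unfolding t_dep using early_d[of "Suc n" v] by auto
  qed
  moreover have "set (q_prune ?s) = {v \<in> pverts G.
      (d v \<le> Suc n \<or> early_shadowed (Suc n) v) \<and> shadowed G R r v}"
  proof -
    have "set (q_prune ?s) = set (q_prune t) \<union> {v. v \<in> set ys \<and> vdepth t v = None}"
      by (simp add: fold_prune_visit t'_def)
    then show ?thesis unfolding new' t_qp using early by auto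
  qed
  moreover have "q_label ?s = q_label t" "labels ?s = labels t"
    by (simp_all add: fold_prune_visit t'_def)
  ultimately show ?thesis
    unfolding round bfs_invariant_def using t_ql t_lab n_def by simp
qed

lemma pruned_bfs_labels:
  assumes "adjacency_lists G nbs" "e \<in> pruned_bfs nbs R r L v"
  shows "e \<in> L v \<or> e = (r, d v) \<and> \<not> shadowed G R r v"
proof -
  define D where "D = Max (d ` pverts G)"
  let ?s = "while (\<lambda>s. at_depth s (level s) (q_label s) \<noteq> []) (bfs_round nbs R r) (bfs_init r L)"
  have "bfs_invariant L ?s"
  \<comment> \<open>Termination: the loop condition provides a vertex at distance
    \<open>level s\<close>, so the level is at most the eccentricity \<open>D\<close> of
    \<open>r\<close>. The \<open>Suc\<close> keeps the decrease strict in a round at level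
    \<open>D\<close>.\<close>
  proof (rule while_rule[where P = "bfs_invariant L" and r = "measure (\<lambda>s. Suc D - level s)"])
    fix s :: "'v bfs_state"
    assume s: "bfs_invariant L s" "at_depth s (level s) (q_label s) \<noteq> []"
    then obtain v where "v \<in> set (q_label s)" "vdepth s v = Some (level s)"
      unfolding at_depth_def by (auto simp: filter_empty_conv)
    with s(1) have "v \<in> pverts G" "d v = level s"
      unfolding bfs_invariant_def by (auto split: if_splits)
    then have "level s \<le> D" unfolding D_def by (metis Max_ge finite_imageI imageI finite_verts)
    then show "(bfs_round nbs R r s, s) \<in> measure (\<lambda>s. Suc D - level s)"
      using bfs_round_invariant[OF assms(1) s(1)] by simp
  qed (use bfs_invariant_init bfs_round_invariant assms(1) in auto)
  with assms(2) show ?thesis unfolding bfs_invariant_def pruned_bfs_def by blast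
qed

end

section \<open>Accumulated labels and comparison of sizes\<close>

lemma highway_labelling_entries:
  assumes "set rs \<subseteq> pverts G" "adjacency_lists G nbs" "e \<in> highway_labelling nbs rs v"
  shows "\<exists>r\<in>set rs. e = (r, graph_dist G r v) \<and> \<not> shadowed G (set rs) r v"
proof -
  \<comment> \<open>The induction runs over the landmarks processed so far, from the end of the
    list, while the pruning set stays \<open>set rs\<close>.\<close>
  have "\<exists>r\<in>set xs. e = (r, graph_dist G r v) \<and> \<not> shadowed G (set rs) r v"
    if "set xs \<subseteq> set rs" "e \<in> fold (pruned_bfs nbs (set rs)) xs (\<lambda>_. {}) v" for xs e v
    using that
  proof (induction xs arbitrary: e v rule: rev_induct)
    case (snoc x xs)
    then show ?case
      using pruned_bfs_labels[OF assms(1) _ assms(2), of x e _ v] by fastforce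
  qed simp
  then show ?thesis using assms(3) unfolding highway_labelling_def by blast
qed

end

theorem theorem3p12:
  fixes G :: "'v pair_pre_digraph"
    and R :: "'v set"
    and \<delta>\<^sub>H :: "'v \<Rightarrow> 'v \<Rightarrow> nat"
    and nbs :: "'v \<Rightarrow> 'v list"
    and rs :: "'v list"
    and L L' :: "'v labelling"
  assumes "pair_pseudo_graph G"
    and "Digraph_Component.connected (with_proj G)"
    and "R \<subseteq> pverts G"
    and "is_highway G (R, \<delta>\<^sub>H)"
    and "adjacency_lists G nbs"
    and "distinct rs" and "set rs = R"
    and "L = highway_labelling nbs rs"
    and "highway_cover_labelling G (R, \<delta>\<^sub>H) L'"
  shows "labelling_size G R L' \<ge> labelling_size G R L"
proof -
  interpret pair_pseudo_graph G by fact
  interpret connected_pair_pseudo_graph G by unfold_locales fact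
  have "card (L v) \<le> card (L' v)" if v: "v \<in> pverts G - R" for v
  proof (rule card_mono)
    \<comment> \<open>Finiteness of \<open>L' v\<close> matters because \<open>card\<close> is 0 on
      infinite sets; it holds since each landmark determines its entry and \<open>R\<close> is the
      set of a list.\<close>
    have "L' v \<subseteq> (\<lambda>r. (r, graph_dist G r v)) ` R"
      using assms(9) v unfolding highway_cover_labelling_def distance_labelling_def by fastforce
    then show "finite (L' v)" using assms(7) finite_subset by blast
    show "L v \<subseteq> L' v"
      using highway_labelling_entries[of rs nbs _ v] highway_cover_contains_unshadowed[OF assms(9) v]
        assms(3,5,7,8) by blast
  qed
  then show ?thesis unfolding labelling_size_def by (rule sum_mono)
qed

end
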